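(* Let $a,b,c\geq 1$ be integers and let $x$ be a nonzero complex number with $x^3\neq 1$. Let $n\geq 1$ be an integer. Then $$\mathcal{BJ}_{n+1}^{(a,b,c)}(x)\,\mathcal{BJ}_{n-1}^{(a,b,c)}(x)-\left(\mathcal{BJ}_{n}^{(a,b,c)}(x)\right)^{2}=\frac{1}{(x^{2}+x+1)^{2}}\Big(-(x^{2}+x+1)\Phi_{1}\Phi_{2}+ x^{n+1}\Theta \left(\mathcal{B}_{n-1}(1)-x^{-1}\mathcal{B}_{n}(1)\right)\Big).$$
   Context: The third-order Jacobsthal polynomials are defined, for $x^3\neq 1$, by $\mathcal{J}_{0}^{(3)}(x)=0$, $\mathcal{J}_{1}^{(3)}(x)=1$, $\mathcal{J}_{2}^{(3)}(x)=x-1$ and $\mathcal{J}_{n+3}^{(3)}(x)=(x-1)\mathcal{J}_{n+2}^{(3)}(x)+(x-1)\mathcal{J}_{n+1}^{(3)}(x)+x\mathcal{J}_{n}^{(3)}(x)$ for $n\geq 0$. Bihyperbolic numbers are the elements $a_0+a_1j_1+a_2j_2+a_3j_3$ with multiplication determined by $j_1^2=j_2^2=j_3^2=1$, $j_1j_2=j_2j_1=j_3$, $j_1j_3=j_3j_1=j_2$, $j_2j_3=j_3j_2=j_1$; this gives a commutative associative unital algebra with basis $1,j_1,j_2,j_3$ (over $\mathbb{R}$ for bihyperbolic numbers proper). All identities are read in its complexification, i.e. coefficients $a_i$ are allowed to be complex. For integers $a,b,c\geq1$ and $n\geq 0$, the generalized bihyperbolic third-order Jacobsthal polynomial is $\mathcal{BJ}_{n}^{(a,b,c)}(x)=\mathcal{J}_{n}^{(3)}(x)+\mathcal{J}_{n+a}^{(3)}(x)j_{1}+\mathcal{J}_{n+b}^{(3)}(x)j_{2}+\mathcal{J}_{n+c}^{(3)}(x)j_{3}$.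 Let $\omega_1,\omega_2$ be the two (complex) roots of $\lambda^2+\lambda+1=0$. Put $\Theta=1+x^{a}j_{1}+x^{b}j_{2}+x^{c}j_{3}$, $\Phi_{1}=1+\omega_{1}^{a}j_{1}+\omega_{1}^{b}j_{2}+\omega_{1}^{c}j_{3}$, $\Phi_{2}=1+\omega_{2}^{a}j_{1}+\omega_{2}^{b}j_{2}+\omega_{2}^{c}j_{3}$, $\mathcal{Z}_{n}(x)=\frac{1}{\omega_{1}-\omega_{2}}\left((\omega_{1}x-1)\omega_{1}^{n}\Phi_{1}-(\omega_{2}x-1)\omega_{2}^{n}\Phi_{2}\right)$ and $\mathcal{B}_{n}(p)=\mathcal{Z}_{n+p}(x)-x^{p}\mathcal{Z}_{n}(x)$. *)

theory Defs
  imports Complex_Main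
begin

fun jacobsthal3 :: "'a::comm_ring_1 \<Rightarrow> nat \<Rightarrow> 'a" where
  "jacobsthal3 x 0 = 0"
| "jacobsthal3 x (Suc 0) = 1"
| "jacobsthal3 x (Suc (Suc 0)) = x - 1"
| "jacobsthal3 x (Suc (Suc (Suc n))) =
     (x - 1) * jacobsthal3 x (Suc (Suc n)) + (x - 1) * jacobsthal3 x (Suc n) + x * jacobsthal3 x n"

text \<open>
  Bihyperbolic numbers with coefficients in a commutative ring: the type \<open>real bihyp\<close> is the
  algebra of bihyperbolic numbers proper, and \<open>complex bihyp\<close> is its complexification.
  \<open>Bihyp a0 a1 a2 a3\<close> stands for \<open>a0 + a1 j1 + a2 j2 + a3 j3\<close> (see \<open>Bihyp_expand\<close> below).
\<close>

datatype 'a bihyp = Bihyp (bh0: 'a) (bh1: 'a) (bh2: 'a) (bh3: 'a)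

lemma bihyp_eq_iff:
  "z = w \<longleftrightarrow> bh0 z = bh0 w \<and> bh1 z = bh1 w \<and> bh2 z = bh2 w \<and> bh3 z = bh3 w"
  by (cases z; cases w) simp

instantiation bihyp :: (comm_ring_1) comm_ring_1
begin

definition zero_bihyp :: "'a bihyp" where "0 = Bihyp 0 0 0 0"

definition one_bihyp :: "'a bihyp" where "1 = Bihyp 1 0 0 0"

definition plus_bihyp :: "'a bihyp \<Rightarrow> 'a bihyp \<Rightarrow> 'a bihyp" where
  "z + w = Bihyp (bh0 z + bh0 w) (bh1 z + bh1 w) (bh2 z + bh2 w) (bh3 z + bh3 w)"

definition uminus_bihyp :: "'a bihyp \<Rightarrow> 'a bihyp" where
  "- z = Bihyp (- bh0 z) (- bh1 z) (- bh2 z) (- bh3 z)"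

definition minus_bihyp :: "'a bihyp \<Rightarrow> 'a bihyp \<Rightarrow> 'a bihyp" where
  "z - w = Bihyp (bh0 z - bh0 w) (bh1 z - bh1 w) (bh2 z - bh2 w) (bh3 z - bh3 w)"

text \<open>
  The bilinear extension of the multiplication table of the units; the table is recovered in
  \<open>bihyp_units_mult\<close> and bilinearity in \<open>bh_scale_mult_left\<close> and \<open>bh_scale_mult_right\<close>.
\<close>

definition times_bihyp :: "'a bihyp \<Rightarrow> 'a bihyp \<Rightarrow> 'a bihyp" where
  "z * w = Bihyp
     (bh0 z * bh0 w + bh1 z * bh1 w + bh2 z * bh2 w + bh3 z * bh3 w)
     (bh0 z * bh1 w + bh1 z * bh0 w + bh2 z * bh3 w + bh3 z * bh2 w)
     (bh0 z * bh2 w + bh2 z * bh0 w + bh1 z * bh3 w + bh3 z * bh1 w)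
     (bh0 z * bh3 w + bh3 z * bh0 w + bh1 z * bh2 w + bh2 z * bh1 w)"

instance
  by standard
    (simp_all add: bihyp_eq_iff zero_bihyp_def one_bihyp_def plus_bihyp_def uminus_bihyp_def
      minus_bihyp_def times_bihyp_def algebra_simps)

end

definition bh_scale :: "'a::comm_ring_1 \<Rightarrow> 'a bihyp \<Rightarrow> 'a bihyp" (infixr \<open>*\<^sub>B\<close> 75) where
  "r *\<^sub>B z = Bihyp (r * bh0 z) (r * bh1 z) (r * bh2 z) (r * bh3 z)"

definition j1 :: "'a::comm_ring_1 bihyp" where "j1 = Bihyp 0 1 0 0"
definition j2 :: "'a::comm_ring_1 bihyp" where "j2 = Bihyp 0 0 1 0"
definition j3 :: "'a::comm_ring_1 bihyp" where "j3 = Bihyp 0 0 0 1"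

lemmas bihyp_defs = zero_bihyp_def one_bihyp_def plus_bihyp_def uminus_bihyp_def
  minus_bihyp_def times_bihyp_def bh_scale_def j1_def j2_def j3_def

lemma Bihyp_expand: "Bihyp a0 a1 a2 a3 = a0 *\<^sub>B 1 + a1 *\<^sub>B j1 + a2 *\<^sub>B j2 + a3 *\<^sub>B j3"
  by (simp add: bihyp_defs)

lemma bihyp_units_mult:
  "j1 * j1 = (1 :: 'a::comm_ring_1 bihyp)" "j2 * j2 = (1 :: 'a bihyp)" "j3 * j3 = (1 :: 'a bihyp)"
  "j1 * j2 = (j3 :: 'a bihyp)" "j2 * j1 = (j3 :: 'a bihyp)"
  "j1 * j3 = (j2 :: 'a bihyp)" "j3 * j1 = (j2 :: 'a bihyp)"
  "j2 * j3 = (j1 :: 'a bihyp)" "j3 * j2 = (j1 :: 'a bihyp)"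
  by (simp_all add: bihyp_defs)

lemma module_bh_scale: "module ((*\<^sub>B) :: 'a::comm_ring_1 \<Rightarrow> 'a bihyp \<Rightarrow> 'a bihyp)"
  by standard (simp_all add: bihyp_defs algebra_simps)

lemma bh_scale_mult_left: "(r *\<^sub>B z) * w = r *\<^sub>B (z * w)"
  by (simp add: bihyp_defs algebra_simps)

lemma bh_scale_mult_right: "z * (r *\<^sub>B w) = r *\<^sub>B (z * w)"
  by (simp add: bihyp_defs algebra_simps)

definition BJ :: "nat \<Rightarrow> nat \<Rightarrow> nat \<Rightarrow> 'a::comm_ring_1 \<Rightarrow> nat \<Rightarrow> 'a bihyp" where
  "BJ a b c x n = jacobsthal3 x n *\<^sub>B 1 + jacobsthal3 x (n + a) *\<^sub>B j1
     + jacobsthal3 x (n + b) *\<^sub>B j2 + jacobsthal3 x (n + c) *\<^sub>B j3"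

definition Theta :: "nat \<Rightarrow> nat \<Rightarrow> nat \<Rightarrow> 'a::comm_ring_1 \<Rightarrow> 'a bihyp" where
  "Theta a b c x = 1 + x ^ a *\<^sub>B j1 + x ^ b *\<^sub>B j2 + x ^ c *\<^sub>B j3"

definition Phi :: "nat \<Rightarrow> nat \<Rightarrow> nat \<Rightarrow> 'a::comm_ring_1 \<Rightarrow> 'a bihyp" where
  "Phi a b c \<omega> = 1 + \<omega> ^ a *\<^sub>B j1 + \<omega> ^ b *\<^sub>B j2 + \<omega> ^ c *\<^sub>B j3"

text \<open>
  In \<open>BZ\<close> and \<open>BB\<close> the arguments \<open>\<omega>1\<close>, \<open>\<omega>2\<close> are meant to be the two roots of
  \<open>\<lambda>\<^sup>2 + \<lambda> + 1\<close>.
\<close>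

definition BZ :: "nat \<Rightarrow> nat \<Rightarrow> nat \<Rightarrow> 'a::field \<Rightarrow> 'a \<Rightarrow> 'a \<Rightarrow> nat \<Rightarrow> 'a bihyp" where
  "BZ a b c \<omega>1 \<omega>2 x n = (1 / (\<omega>1 - \<omega>2)) *\<^sub>B
     (((\<omega>1 * x - 1) * \<omega>1 ^ n) *\<^sub>B Phi a b c \<omega>1 - ((\<omega>2 * x - 1) * \<omega>2 ^ n) *\<^sub>B Phi a b c \<omega>2)"

definition BB :: "nat \<Rightarrow> nat \<Rightarrow> nat \<Rightarrow> 'a::field \<Rightarrow> 'a \<Rightarrow> 'a \<Rightarrow> nat \<Rightarrow> nat \<Rightarrow> 'a bihyp" where
  "BB a b c \<omega>1 \<omega>2 x n p = BZ a b c \<omega>1 \<omega>2 x (n + p) - x ^ p *\<^sub>B BZ a b c \<omega>1 \<omega>2 x n"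

end

theory Submission
  imports Defs
begin

text \<open>
  The characteristic polynomial of the third-order Jacobsthal recurrence factors as
  \<open>\<lambda>\<^sup>3 - (x - 1) \<lambda>\<^sup>2 - (x - 1) \<lambda> - x = (\<lambda> - x) (\<lambda>\<^sup>2 + \<lambda> + 1)\<close>, so its roots are \<open>x\<close>, \<open>\<omega>1\<close>, \<open>\<omega>2\<close>.
  With \<open>q = x\<^sup>2 + x + 1\<close> this gives a Binet formula, first for the polynomials and then, read off
  coefficient by coefficient, for their bihyperbolic versions (\<open>BJ_binet\<close>):
  \<open>q BJ\<^sub>n = x\<^sup>n\<^sup>+\<^sup>1 \<Theta> - Z\<^sub>n\<close>.

  Substituting it into \<open>q\<^sup>2 (BJ\<^sub>n\<^sub>+\<^sub>1 BJ\<^sub>n\<^sub>-\<^sub>1 - BJ\<^sub>n\<^sup>2)\<close>, the terms in \<open>\<Theta>\<^sup>2\<close> cancel because \<open>x\<^sup>n\<^sup>+\<^sup>1\<close> is a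
  geometric progression. The terms linear in \<open>\<Theta>\<close> are
  \<open>- x\<^sup>n \<Theta> (Z\<^sub>n\<^sub>+\<^sub>1 - 2 x Z\<^sub>n + x\<^sup>2 Z\<^sub>n\<^sub>-\<^sub>1)\<close>. The twisted second difference in parentheses is
  \<open>B\<^sub>n(1) - x B\<^sub>n\<^sub>-\<^sub>1(1)\<close> with \<open>B\<^sub>k(1) = Z\<^sub>k\<^sub>+\<^sub>1 - x Z\<^sub>k\<close>; taking out the factor \<open>- x\<close> produces the
  \<open>x\<^sup>n\<^sup>+\<^sup>1\<close> and \<open>x\<^sup>-\<^sup>1\<close> of the claim, and here \<open>x \<noteq> 0\<close> enters. The condition \<open>x\<^sup>3 \<noteq> 1\<close> makes \<open>q\<close>
  invertible, as \<open>x\<^sup>3 - 1 = (x - 1) q\<close>. What remains is the Cassini expression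
  \<open>Z\<^sub>n\<^sub>+\<^sub>1 Z\<^sub>n\<^sub>-\<^sub>1 - Z\<^sub>n\<^sup>2\<close> (\<open>BZ_cassini\<close>). As \<open>Z\<close> is a combination of the two geometric progressions
  \<open>\<omega>1\<^sup>n \<Phi>\<^sub>1\<close> and \<open>\<omega>2\<^sup>n \<Phi>\<^sub>2\<close>, only the mixed product survives; its coefficient does not depend on
  \<open>n\<close> because \<open>\<omega>1 \<omega>2 = 1\<close>, and it equals \<open>-q\<close> because \<open>(\<omega>1 x - 1) (\<omega>2 x - 1) = q\<close>.
\<close>

lemma vieta_cyclotomic3:
  fixes \<omega>1 \<omega>2 :: "'a::field"
  assumes "\<omega>1 ^ 2 + \<omega>1 + 1 = 0" and "\<omega>2 ^ 2 + \<omega>2 + 1 = 0" and "\<omega>1 \<noteq> \<omega>2"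
  shows "\<omega>1 + \<omega>2 = -1" and "\<omega>1 * \<omega>2 = 1"
proof -
  have "(\<omega>1 - \<omega>2) * (\<omega>1 + \<omega>2 + 1) = 0"
    using assms(1,2) by algebra
  hence "\<omega>1 + \<omega>2 + 1 = 0"
    using assms(3) by simp
  thus "\<omega>1 + \<omega>2 = -1"
    by (simp add: eq_neg_iff_add_eq_0)
  thus "\<omega>1 * \<omega>2 = 1"
    using assms(1) by algebra
qed

text \<open>
  Both sides satisfy the same third-order recurrence, so it is enough to compare three initial
  values. Clearing the denominators \<open>x\<^sup>2 + x + 1\<close> and \<open>\<omega>1 - \<omega>2\<close> keeps every step a
  polynomial identity modulo the equations for \<open>\<omega>1\<close> and \<open>\<omega>2\<close>.
\<close>

lemma jacobsthal3_binet:
  fixes x \<omega>1 \<omega>2 :: "'a::field"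
  assumes "\<omega>1 ^ 2 + \<omega>1 + 1 = 0" and "\<omega>2 ^ 2 + \<omega>2 + 1 = 0" and "\<omega>1 \<noteq> \<omega>2"
  shows "(\<omega>1 - \<omega>2) * ((x ^ 2 + x + 1) * jacobsthal3 x n) =
    (\<omega>1 - \<omega>2) * x ^ (n + 1) - ((\<omega>1 * x - 1) * \<omega>1 ^ n - (\<omega>2 * x - 1) * \<omega>2 ^ n)"
proof -
  note vieta = vieta_cyclotomic3[OF assms]
  show ?thesis
  proof (induction x n rule: jacobsthal3.induct)
    case (1 x)
    show ?case by (simp add: algebra_simps)
  next
    case (2 x)
    show ?case using vieta assms(1,2) by simp algebra
  next
    case (3 x)
    show ?case using vieta assms(1,2) by (simp add: power2_eq_square) algebra
  next
    case (4 x n)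
    define X A B where "X = x ^ (n + 1)" and "A = \<omega>1 ^ n" and "B = \<omega>2 ^ n"
    (* Powers of a root of the characteristic polynomial solve the recurrence: it is divisible by
       r^2 + r + 1, and x is its third root. *)
    have root: "r * (r * (r * y)) = (x - 1) * (r * (r * y)) + (x - 1) * (r * y) + x * y"
      if "r ^ 2 + r + 1 = 0" for r y
      using that by algebra
    have rec: "x * (x * (x * X)) = (x - 1) * (x * (x * X)) + (x - 1) * (x * X) + x * X"
      by (simp add: algebra_simps)
    show ?case
      using 4 rec root[OF assms(1), of A] root[OF assms(2), of B]
      unfolding jacobsthal3.simps add_Suc power_Suc X_def[symmetric] A_def[symmetric]
        B_def[symmetric]
      by algebra
  qed
qed

text \<open>
  The coefficient at each of the four units is the scalar Binet formula at index \<open>n\<close>, \<open>n + a\<close>,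
  \<open>n + b\<close> or \<open>n + c\<close>; splitting the powers accounts for \<open>\<Theta>\<close> and the \<open>\<Phi>\<close>'s.
\<close>

lemma BJ_binet:
  fixes x \<omega>1 \<omega>2 :: "'a::field"
  assumes "\<omega>1 ^ 2 + \<omega>1 + 1 = 0" and "\<omega>2 ^ 2 + \<omega>2 + 1 = 0" and "\<omega>1 \<noteq> \<omega>2"
  shows "(x ^ 2 + x + 1) *\<^sub>B BJ a b c x n =
    x ^ (n + 1) *\<^sub>B Theta a b c x - BZ a b c \<omega>1 \<omega>2 x n"
proof -
  have J: "(x ^ 2 + x + 1) * jacobsthal3 x k =
    x ^ (k + 1) - 1 / (\<omega>1 - \<omega>2) * ((\<omega>1 * x - 1) * \<omega>1 ^ k - (\<omega>2 * x - 1) * \<omega>2 ^ k)" for k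
    using jacobsthal3_binet[OF assms, of x k] assms(3) by (simp add: field_simps)
  show ?thesis
    unfolding bihyp_eq_iff BJ_def Theta_def BZ_def Phi_def bihyp_defs bihyp.sel
    by (simp add: J) (simp add: power_add mult_ac)
qed

lemma bh_scale_eq_mult: "r *\<^sub>B z = Bihyp r 0 0 0 * z"
  by (simp add: bihyp_defs)

text \<open>
  After expansion, \<open>P\<^sup>2\<close> and \<open>Q\<^sup>2\<close> have the coefficients \<open>u2 u0 - u1\<^sup>2\<close> and \<open>v2 v0 - v1\<^sup>2\<close>, which
  vanish when the three values of \<open>u\<close> and of \<open>v\<close> are in geometric progression.
\<close>

lemma cassini_two_geometric:
  fixes P Q :: "'a::comm_ring_1 bihyp"
  assumes u: "u2 * u0 = u1 ^ 2" and v: "v2 * v0 = v1 ^ 2"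
  shows "(u2 *\<^sub>B P - v2 *\<^sub>B Q) * (u0 *\<^sub>B P - v0 *\<^sub>B Q) - (u1 *\<^sub>B P - v1 *\<^sub>B Q) ^ 2 =
    (2 * u1 * v1 - u2 * v0 - v2 * u0) *\<^sub>B (P * Q)"
proof -
  (* Scalars become ring elements, so that the claim is an identity in one commutative ring. *)
  define s :: "'a \<Rightarrow> 'a bihyp" where "s r = Bihyp r 0 0 0" for r
  have s_mult: "s (r * t) = s r * s t" and s_diff: "s (r - t) = s r - s t"
    and s_two: "s 2 = 2" for r t
    unfolding one_add_one[symmetric] s_def by (simp_all add: bihyp_defs)
  have "s u2 * s u0 = s u1 ^ 2" and "s v2 * s v0 = s v1 ^ 2"
    using u v by (simp_all add: s_mult[symmetric] power2_eq_square)
  moreover have "(s u2 * P - s v2 * Q) * (s u0 * P - s v0 * Q) - (s u1 * P - s v1 * Q) ^ 2 =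
      (s u2 * s u0 - s u1 ^ 2) * P ^ 2 + (s v2 * s v0 - s v1 ^ 2) * Q ^ 2
        + (2 * s u1 * s v1 - s u2 * s v0 - s v2 * s u0) * (P * Q)"
    by (simp add: power2_eq_square algebra_simps)
  ultimately show ?thesis
    unfolding bh_scale_eq_mult s_def[symmetric] s_mult s_diff s_two by simp
qed

lemma BZ_cassini:
  fixes x \<omega>1 \<omega>2 :: "'a::field"
  assumes "\<omega>1 ^ 2 + \<omega>1 + 1 = 0" and "\<omega>2 ^ 2 + \<omega>2 + 1 = 0" and "\<omega>1 \<noteq> \<omega>2"
  shows "BZ a b c \<omega>1 \<omega>2 x (m + 2) * BZ a b c \<omega>1 \<omega>2 x m - (BZ a b c \<omega>1 \<omega>2 x (m + 1)) ^ 2 =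
    (- (x ^ 2 + x + 1)) *\<^sub>B (Phi a b c \<omega>1 * Phi a b c \<omega>2)"
proof -
  note vieta = vieta_cyclotomic3[OF assms]
  define d where "d = 1 / (\<omega>1 - \<omega>2)"
  define u where "u k = d * ((\<omega>1 * x - 1) * \<omega>1 ^ k)" for k
  define v where "v k = d * ((\<omega>2 * x - 1) * \<omega>2 ^ k)" for k
  have d: "d * (\<omega>1 - \<omega>2) = 1"
    using assms(3) by (simp add: d_def)
  have Z: "BZ a b c \<omega>1 \<omega>2 x k = u k *\<^sub>B Phi a b c \<omega>1 - v k *\<^sub>B Phi a b c \<omega>2" for k
    unfolding BZ_def u_def v_def d_def
    by (simp add: bihyp_defs algebra_simps)
  (* The mixed coefficient is -d^2 (\<omega>1 - \<omega>2)^2 times the product of the two leading factors and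
     of the two m-th powers: 2 \<omega>1 \<omega>2 - \<omega>1^2 - \<omega>2^2 = -(\<omega>1 - \<omega>2)^2. *)
  have pow: "\<omega>1 ^ m * \<omega>2 ^ m = 1"
    using vieta(2) by (simp add: power_mult_distrib[symmetric])
  have norm: "(\<omega>1 * x - 1) * (\<omega>2 * x - 1) = x ^ 2 + x + 1"
    using vieta by algebra
  have "2 * u (m + 1) * v (m + 1) - u (m + 2) * v m - v (m + 2) * u m =
      - ((d * (\<omega>1 - \<omega>2)) ^ 2 * ((\<omega>1 * x - 1) * (\<omega>2 * x - 1)) * (\<omega>1 ^ m * \<omega>2 ^ m))"
    by (simp add: u_def v_def power_add power2_eq_square algebra_simps)
  also have "\<dots> = - (x ^ 2 + x + 1)"
    by (simp only: d pow norm) simp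
  finally have coeff: "2 * u (m + 1) * v (m + 1) - u (m + 2) * v m - v (m + 2) * u m =
      - (x ^ 2 + x + 1)" .
  have "u (m + 2) * u m = u (m + 1) ^ 2" and "v (m + 2) * v m = v (m + 1) ^ 2"
    by (simp_all add: u_def v_def power_add power2_eq_square mult_ac)
  from cassini_two_geometric[OF this, of "Phi a b c \<omega>1" "Phi a b c \<omega>2"]
  show ?thesis
    unfolding Z coeff .
qed

theorem corollary2p8:
  fixes a b c n :: nat and x \<omega>1 \<omega>2 :: complex
  assumes "a \<ge> 1" and "b \<ge> 1" and "c \<ge> 1"
    and "x \<noteq> 0" and "x ^ 3 \<noteq> 1"
    and "n \<ge> 1"
    and "\<omega>1 ^ 2 + \<omega>1 + 1 = 0" and "\<omega>2 ^ 2 + \<omega>2 + 1 = 0" and "\<omega>1 \<noteq> \<omega>2"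
  shows "BJ a b c x (n + 1) * BJ a b c x (n - 1) - (BJ a b c x n) ^ 2 =
    (1 / (x ^ 2 + x + 1) ^ 2) *\<^sub>B
      ((- (x ^ 2 + x + 1)) *\<^sub>B (Phi a b c \<omega>1 * Phi a b c \<omega>2)
        + x ^ (n + 1) *\<^sub>B (Theta a b c x *
            (BB a b c \<omega>1 \<omega>2 x (n - 1) 1 - inverse x *\<^sub>B BB a b c \<omega>1 \<omega>2 x n 1)))"
proof -
  obtain m where n: "n = m + 1"
    using \<open>n \<ge> 1\<close> by (metis le_add_diff_inverse2)
  define q where "q = x ^ 2 + x + 1"
  define J where "J = BJ a b c x"
  define Z where "Z = BZ a b c \<omega>1 \<omega>2 x"
  define T where "T = Theta a b c x"
  define W where "W = Phi a b c \<omega>1 * Phi a b c \<omega>2"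
  have "x ^ 3 - 1 = (x - 1) * q"
    by (simp add: q_def power2_eq_square power3_eq_cube algebra_simps)
  hence q: "q \<noteq> 0"
    using \<open>x ^ 3 \<noteq> 1\<close> by auto
  (* Scalars are embedded as ring elements, so that the rest is ring arithmetic. *)
  define s :: "complex \<Rightarrow> complex bihyp" where "s r = Bihyp r 0 0 0" for r
  have s_mult: "s (r * t) = s r * s t" for r t
    by (simp add: s_def bihyp_defs)
  have s_one: "s 1 = 1"
    by (simp add: s_def bihyp_defs)
  have scale: "r *\<^sub>B z = s r * z" for r z
    by (simp add: s_def bh_scale_eq_mult)
  have s_power: "s (r ^ k) = s r ^ k" for r k
    by (induction k) (simp_all add: s_one s_mult)
  have binet: "s q * J k = s x ^ (k + 1) * T - Z k" for k
    using BJ_binet[OF assms(7-9), where x = x and a = a and b = b and c = c and n = k]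
    by (simp only: scale s_power q_def J_def Z_def T_def)
  have cassini: "Z (m + 2) * Z m - Z (m + 1) ^ 2 = s (- q) * W"
    using BZ_cassini[OF assms(7-9)] by (simp add: scale q_def Z_def W_def)
  have "s x ^ (m + 2) * s (inverse x) = s x ^ (m + 1) * (s x * s (inverse x))"
    by (simp add: mult_ac)
  also have "s x * s (inverse x) = 1"
    using \<open>x \<noteq> 0\<close> by (simp add: s_mult[symmetric] s_one)
  finally have inv: "s x ^ (m + 1) = s x ^ (m + 2) * s (inverse x)"
    by simp
  have "s q ^ 2 * (J (m + 2) * J m - J (m + 1) ^ 2) =
      (s q * J (m + 2)) * (s q * J m) - (s q * J (m + 1)) ^ 2"
    by (simp add: power2_eq_square algebra_simps)
  also have "\<dots> = (s x ^ (m + 3) * T - Z (m + 2)) * (s x ^ (m + 1) * T - Z m)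
      - (s x ^ (m + 2) * T - Z (m + 1)) ^ 2"
    by (simp add: binet eval_nat_numeral)
  also have "\<dots> = Z (m + 2) * Z m - Z (m + 1) ^ 2
      + (s x ^ (m + 2) * (T * (Z (m + 1) - s x * Z m))
        - s x ^ (m + 1) * (T * (Z (m + 2) - s x * Z (m + 1))))"
    by (simp add: power_add eval_nat_numeral algebra_simps)
  also have "\<dots> = Z (m + 2) * Z m - Z (m + 1) ^ 2
      + s x ^ (m + 2) * (T * ((Z (m + 1) - s x * Z m)
          - s (inverse x) * (Z (m + 2) - s x * Z (m + 1))))"
    unfolding inv by (simp only: right_diff_distrib mult_ac)
  finally have main: "s q ^ 2 * (J (m + 2) * J m - J (m + 1) ^ 2) = s (- q) * W
      + s x ^ (m + 2) * (T * ((Z (m + 1) - s x * Z m)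
          - s (inverse x) * (Z (m + 2) - s x * Z (m + 1))))" (is "_ = ?R")
    unfolding cassini .
  have "s (1 / q ^ 2) * s q ^ 2 = 1"
    using q by (simp add: s_power[symmetric] s_mult[symmetric] s_one)
  hence "J (m + 2) * J m - J (m + 1) ^ 2 = s (1 / q ^ 2) * ?R"
    unfolding main[symmetric] by (simp add: mult.assoc[symmetric])
  thus ?thesis
    unfolding n BB_def q_def[symmetric] J_def[symmetric] Z_def[symmetric] T_def[symmetric]
      W_def[symmetric]
    by (simp add: scale s_power s_mult)
qed

end
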